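(* Let $M$ be a connected $2$-polymatroid and let $N$ be a connected proper minor of $M$. Then there is a unique constrained admissible ordering of $E(M)-E(N)$ if and only if $|E(M)-E(N)|=1$.
   Context: For a positive integer $k$, a $k$-polymatroid $M$ is a pair $(E,r)$ consisting of a finite set $E=E(M)$ (the ground set) and a function $r=r_M$ (the rank function) from the power set of $E$ into the integers such that: (i) $r(\emptyset)=0$; (ii) $r(X)\le r(Y)$ whenever $X\subseteq Y\subseteq E$; (iii) $r(X)+r(Y)\ge r(X\cup Y)+r(X\cap Y)$ for all $X,Y\subseteq E$; (iv) $r(\{e\})\le k$ for all $e\in E$. A $2$-polymatroid is the case $k=2$; a polymatroid is a $k$-polymatroid for some $k$. For $T\subseteq E$, the deletion $M\backslash T$ and the contraction $M/T$ are the polymatroids on ground set $E-T$ with rank functions $r_{M\backslash T}(X)=r(X)$ and $r_{M/T}(X)=r(X\cup T)-r(T)$ for all $X\subseteq E-T$. A minor of $M$ is any polymatroid obtained from $M$ by a sequence of deletions and contractions (so its ground set is a subset of $E(M)$); it is proper if it is not equal to $M$. A polymatroid $(E,r)$ is connected if there is no non-empty proper subset $X$ of $E$ such that $r(X)+r(E-X)=r(E)$. Let $M$ be a connected polymatroid and $N$ a connected proper minor of $M$. A constrained admissible ordering of $E(M)-E(N)$ is an ordering $((\alpha_1,a_1),(\alpha_2,a_2),\ldots,(\alpha_n,a_n))$ such that $E(M)-E(N)=\{a_1,a_2,\ldots,a_n\}$ (where $a_1,\ldots,a_n$ are distinct), each $\alpha_i$ is a deletion or contraction operation, and, for each $k\in\{1,2,\ldots,n\}$,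 there is a connected minor $M_k$ of $M$ with ground set $E(M)-\{a_1,a_2,\ldots,a_k\}$ where $M_k$ is obtained from $M_{k-1}$ by removing $a_k$ by the operation designated by $\alpha_k$, and $(M_0,M_n)=(M,N)$.
   Formalization: Assumes |E(M)| ≠ 1: if E(M)={a}, the empty polymatroid N is a connected proper minor with M\a = M/a = N, so there are two constrained admissible orderings although |E(M)-E(N)|=1. *)

theory Defs
  imports Main "HOL-Library.FuncSet"
begin

record 'a polymat =
  ground :: "'a set"
  rk :: "'a set \<Rightarrow> int"

text \<open>The rank function has domain \<open>Pow (ground M)\<close>: it is required to be
  \<^const>\<open>extensional\<close> there (and so takes the value \<^const>\<open>undefined\<close> elsewhere). Hence
  HOL equality of records is equality of polymatroids.\<close>

definition k_polymatroid :: "nat \<Rightarrow> 'a polymat \<Rightarrow> bool" where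
  "k_polymatroid k M \<longleftrightarrow>
     0 < k \<and>
     finite (ground M) \<and>
     rk M \<in> extensional (Pow (ground M)) \<and>
     rk M {} = 0 \<and>
     (\<forall>X Y. X \<subseteq> Y \<and> Y \<subseteq> ground M \<longrightarrow> rk M X \<le> rk M Y) \<and>
     (\<forall>X Y. X \<subseteq> ground M \<and> Y \<subseteq> ground M \<longrightarrow>
        rk M X + rk M Y \<ge> rk M (X \<union> Y) + rk M (X \<inter> Y)) \<and>
     (\<forall>e \<in> ground M. rk M {e} \<le> int k)"

definition delete :: "'a polymat \<Rightarrow> 'a set \<Rightarrow> 'a polymat" where
  "delete M T = \<lparr> ground = ground M - T,
                  rk = (\<lambda>X \<in> Pow (ground M - T). rk M X) \<rparr>"

definition contract :: "'a polymat \<Rightarrow> 'a set \<Rightarrow> 'a polymat" where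
  "contract M T = \<lparr> ground = ground M - T,
                    rk = (\<lambda>X \<in> Pow (ground M - T). rk M (X \<union> T) - rk M T) \<rparr>"

inductive is_minor :: "'a polymat \<Rightarrow> 'a polymat \<Rightarrow> bool" for M :: "'a polymat" where
  refl: "is_minor M M"
| deletion: "is_minor M N \<Longrightarrow> T \<subseteq> ground N \<Longrightarrow> is_minor M (delete N T)"
| contraction: "is_minor M N \<Longrightarrow> T \<subseteq> ground N \<Longrightarrow> is_minor M (contract N T)"

definition proper_minor :: "'a polymat \<Rightarrow> 'a polymat \<Rightarrow> bool" where
  "proper_minor M N \<longleftrightarrow> is_minor M N \<and> N \<noteq> M"

definition connected_pm :: "'a polymat \<Rightarrow> bool" where
  "connected_pm M \<longleftrightarrow>
     \<not> (\<exists>X. X \<noteq> {} \<and> X \<subset> ground M \<and> rk M X + rk M (ground M - X) = rk M (ground M))"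

datatype operation = Deletion | Contraction

fun remove_by :: "operation \<Rightarrow> 'a polymat \<Rightarrow> 'a \<Rightarrow> 'a polymat" where
  "remove_by Deletion M a = delete M {a}"
| "remove_by Contraction M a = contract M {a}"

text \<open>Lists are indexed from 0, so \<open>(\<alpha>\<^sub>k, a\<^sub>k)\<close> is \<open>os ! (k - 1)\<close>, and
  \<open>{a\<^sub>1, \<dots>, a\<^sub>k}\<close> is \<open>snd ` set (take k os)\<close>.\<close>

definition constrained_admissible_ordering ::
    "'a polymat \<Rightarrow> 'a polymat \<Rightarrow> (operation \<times> 'a) list \<Rightarrow> bool" where
  "constrained_admissible_ordering M N os \<longleftrightarrow>
     distinct (map snd os) \<and>
     snd ` set os = ground M - ground N \<and>
     (\<exists>Ms :: nat \<Rightarrow> 'a polymat.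
        Ms 0 = M \<and> Ms (length os) = N \<and>
        (\<forall>k \<in> {1..length os}.
           is_minor M (Ms k) \<and> connected_pm (Ms k) \<and>
           ground (Ms k) = ground M - snd ` set (take k os) \<and>
           Ms k = remove_by (fst (os ! (k - 1))) (Ms (k - 1)) (snd (os ! (k - 1)))))"

end

(* If two consecutive steps of an ordering remove a and then b, they can be replaced by another pair
   of steps with the same outcome, so an ordering of length at least two is never the only one.
   Performing the two operations in the opposite order works unless the new intermediate
   polymatroid is disconnected. In that case it has the remaining element as a direct summand,
   so that element may be deleted or contracted with the same result, which opens further
   routes. They cannot all be blocked: if {a} is a summand of M\b and {b} is a summand of M/a,
   then r(E) = r(ab) + r(E - ab), against the connectivity of M. For one removed element, M\a and
   M/a coincide only if {a} is a summand of M. *)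
theory Submission
  imports Defs
begin

section \<open>Direct summands and elementary rank inequalities\<close>

text \<open>The one-element case of the separation equation in \<open>connected_pm\<close>, but
  \<open>{a}\<close> need not be a proper subset: on the ground set \<open>{a}\<close> it holds as
  soon as the empty set has rank 0.\<close>

definition summand :: "'a polymat \<Rightarrow> 'a \<Rightarrow> bool" where
  "summand K a \<longleftrightarrow> rk K {a} + rk K (ground K - {a}) = rk K (ground K)"

lemma rk_mono:
  assumes "k_polymatroid k K" "X \<subseteq> Y" "Y \<subseteq> ground K"
  shows "rk K X \<le> rk K Y"
  using assms unfolding k_polymatroid_def by blast

lemma rk_submodular:
  assumes "k_polymatroid k K" "X \<subseteq> ground K" "Y \<subseteq> ground K"
  shows "rk K (X \<union> Y) + rk K (X \<inter> Y) \<le> rk K X + rk K Y"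
  using assms unfolding k_polymatroid_def by blast

lemma rk_empty: "k_polymatroid k K \<Longrightarrow> rk K {} = 0"
  unfolding k_polymatroid_def by blast

lemma ground_remove_by [simp]: "ground (remove_by p K a) = ground K - {a}"
  by (cases p) (simp_all add: delete_def contract_def)

section \<open>Closure under deletion and contraction\<close>

lemma k_polymatroid_delete:
  assumes "k_polymatroid k K"
  shows "k_polymatroid k (delete K T)"
proof -
  have "X \<subseteq> ground K - T \<longleftrightarrow> X \<subseteq> ground K \<and> X \<inter> T = {}" for X
    by auto
  then show ?thesis
    using assms unfolding k_polymatroid_def delete_def by auto
qed

text \<open>Monotonicity and submodularity are those of \<open>K\<close> for sets enlarged by
  \<open>T\<close>. The bound on a single element is subadditivity of the rank on the disjoint sets
  \<open>{e}\<close> and \<open>T\<close>.\<close>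

lemma k_polymatroid_contract:
  assumes K: "k_polymatroid k K" and T: "T \<subseteq> ground K"
  shows "k_polymatroid k (contract K T)"
proof -
  have mono: "rk K (X \<union> T) \<le> rk K (Y \<union> T)" if "X \<subseteq> Y" "Y \<subseteq> ground K - T" for X Y
    using that T by (intro rk_mono[OF K]) auto
  have submod: "rk K (X \<union> Y \<union> T) + rk K (X \<inter> Y \<union> T) \<le> rk K (X \<union> T) + rk K (Y \<union> T)"
    if "X \<subseteq> ground K - T" "Y \<subseteq> ground K - T" for X Y
  proof -
    have "(X \<union> T) \<union> (Y \<union> T) = X \<union> Y \<union> T" "(X \<union> T) \<inter> (Y \<union> T) = X \<inter> Y \<union> T"
      by auto
    then show ?thesis
      using rk_submodular[OF K, of "X \<union> T" "Y \<union> T"] that T by auto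
  qed
  have single: "rk K ({e} \<union> T) - rk K T \<le> int k" if e: "e \<in> ground K - T" for e
  proof -
    have "{e} \<inter> T = {}"
      using e by auto
    then have "rk K ({e} \<union> T) \<le> rk K {e} + rk K T"
      using rk_submodular[OF K, of "{e}" T] e T rk_empty[OF K] by simp
    moreover have "rk K {e} \<le> int k"
      using K e unfolding k_polymatroid_def by blast
    ultimately show ?thesis by simp
  qed
  have basic: "0 < k" "finite (ground K)"
    using K unfolding k_polymatroid_def by auto
  show ?thesis
    unfolding k_polymatroid_def
  proof (intro conjI allI ballI impI)
    fix X Y assume XY: "X \<subseteq> Y \<and> Y \<subseteq> ground (contract K T)"
    then have "X \<subseteq> Y" "Y \<subseteq> ground K - T" "X \<subseteq> ground K - T"
      by (auto simp: contract_def)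
    then show "rk (contract K T) X \<le> rk (contract K T) Y"
      using mono[of X Y] by (simp add: contract_def)
  next
    fix X Y assume XY: "X \<subseteq> ground (contract K T) \<and> Y \<subseteq> ground (contract K T)"
    then have "X \<subseteq> ground K - T" "Y \<subseteq> ground K - T"
      "X \<union> Y \<subseteq> ground K - T" "X \<inter> Y \<subseteq> ground K - T"
      by (auto simp: contract_def)
    then show "rk (contract K T) X + rk (contract K T) Y
        \<ge> rk (contract K T) (X \<union> Y) + rk (contract K T) (X \<inter> Y)"
      using submod[of X Y] by (simp add: contract_def)
  next
    fix e assume "e \<in> ground (contract K T)"
    then show "rk (contract K T) {e} \<le> int k"
      using single[of e] by (simp add: contract_def)
  qed (use basic in \<open>auto simp: contract_def\<close>)
qed

lemma k_polymatroid_remove_by: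
  assumes "k_polymatroid k K" "a \<in> ground K"
  shows "k_polymatroid k (remove_by p K a)"
  using assms by (cases p) (simp_all add: k_polymatroid_delete k_polymatroid_contract)

section \<open>Minors that lose at most one element\<close>

text \<open>Equality of records holds here because \<open>rk K\<close> is extensional on
  \<open>Pow (ground K)\<close>, so that restricting it to that domain changes nothing.\<close>

lemma delete_empty:
  assumes "k_polymatroid k K"
  shows "delete K {} = K"
  using assms unfolding k_polymatroid_def delete_def
  by (auto simp: extensional_restrict)

lemma contract_empty:
  assumes "k_polymatroid k K"
  shows "contract K {} = K"
  using assms unfolding k_polymatroid_def contract_def
  by (auto simp: extensional_restrict)

lemma k_polymatroid_minor:
  assumes "is_minor M N" "k_polymatroid k M"
  shows "k_polymatroid k N"
  using assms by (induction rule: is_minor.induct)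
    (simp_all add: k_polymatroid_delete k_polymatroid_contract)

lemma ground_minor: "is_minor M N \<Longrightarrow> ground N \<subseteq> ground M"
  by (induction rule: is_minor.induct) (auto simp: delete_def contract_def)

text \<open>Ground sets only shrink along a sequence of minors, so every step removes the empty set
  and is trivial. Hence a proper minor really loses an element.\<close>

lemma minor_same_ground:
  assumes "is_minor M N" "k_polymatroid k M" "ground N = ground M"
  shows "N = M"
  using assms
proof (induction rule: is_minor.induct)
  case (deletion N T)
  then have "T = {}" "ground N = ground M"
    using ground_minor[OF deletion.hyps(1)] by (auto simp: delete_def)
  then show ?case
    using deletion by (simp add: delete_empty)
next
  case (contraction N T)
  then have "T = {}" "ground N = ground M"
    using ground_minor[OF contraction.hyps(1)] by (auto simp: contract_def)
  then show ?case
    using contraction by (simp add: contract_empty)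
qed simp

text \<open>The set removed in the last step is either empty, and induction applies, or
  \<open>{a}\<close>. In the latter case the previous minor still has the ground set of
  \<open>M\<close> and so equals \<open>M\<close>.\<close>

lemma minor_remove_one:
  assumes "is_minor M N" "k_polymatroid k M" "ground M - ground N = {a}"
  shows "\<exists>p. N = remove_by p M a"
  using assms
proof (induction rule: is_minor.induct)
  case (deletion N T)
  show ?case
  proof (cases "T = {}")
    case True
    then show ?thesis
      using deletion delete_empty[OF k_polymatroid_minor[OF deletion.hyps(1) deletion.prems(1)]]
      by simp
  next
    case False
    have g: "ground M - (ground N - T) = {a}" "ground N \<subseteq> ground M"
      using deletion ground_minor[OF deletion.hyps(1)] by (auto simp: delete_def)
    then have T: "T = {a}"
      using False deletion.hyps(2) by auto
    moreover have "ground N = ground M"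
      using g T deletion.hyps(2) by auto
    ultimately show ?thesis
      using minor_same_ground deletion by (metis remove_by.simps(1))
  qed
next
  case (contraction N T)
  show ?case
  proof (cases "T = {}")
    case True
    then show ?thesis
      using contraction
        contract_empty[OF k_polymatroid_minor[OF contraction.hyps(1) contraction.prems(1)]]
      by simp
  next
    case False
    have g: "ground M - (ground N - T) = {a}" "ground N \<subseteq> ground M"
      using contraction ground_minor[OF contraction.hyps(1)] by (auto simp: contract_def)
    then have T: "T = {a}"
      using False contraction.hyps(2) by auto
    moreover have "ground N = ground M"
      using g T contraction.hyps(2) by auto
    ultimately show ?thesis
      using minor_same_ground contraction by (metis remove_by.simps(2))
  qed
qed simp

lemma is_minor_remove_by:
  assumes "is_minor M K" "a \<in> ground K"
  shows "is_minor M (remove_by p K a)"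
  using assms by (cases p) (auto intro: is_minor.intros)

section \<open>Interchanging removals\<close>

lemma delete_delete: "delete (delete M S) T = delete M (S \<union> T)"
proof -
  have "ground M - S - T = ground M - (S \<union> T)"
    "Pow (ground M - S) \<inter> Pow (ground M - (S \<union> T)) = Pow (ground M - (S \<union> T))"
    by auto
  then show ?thesis
    unfolding delete_def by simp
qed

text \<open>The terms \<open>rk M S\<close> subtracted by the first contraction cancel in the
  second.\<close>

lemma contract_contract:
  assumes "T \<subseteq> ground M" "S \<inter> T = {}"
  shows "contract (contract M S) T = contract M (S \<union> T)"
proof -
  have eq: "ground M - S - T = ground M - (S \<union> T)"
    by auto
  have "rk (contract M S) (X \<union> T) - rk (contract M S) T = rk M (X \<union> (S \<union> T)) - rk M (S \<union> T)"
    if "X \<subseteq> ground M - (S \<union> T)" for X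
  proof -
    have "X \<union> T \<subseteq> ground M - S" "T \<subseteq> ground M - S"
      using that assms by auto
    moreover have "X \<union> T \<union> S = X \<union> (S \<union> T)" "T \<union> S = S \<union> T"
      by auto
    ultimately show ?thesis
      by (simp add: contract_def)
  qed
  moreover have "ground (contract M S) = ground M - S"
    by (simp add: contract_def)
  ultimately show ?thesis
    unfolding contract_def[of _ T] contract_def[of _ "S \<union> T"] eq[symmetric]
    by (auto intro!: restrict_ext simp: eq)
qed

lemma delete_contract:
  assumes "S \<subseteq> ground M" "S \<inter> T = {}"
  shows "delete (contract M S) T = contract (delete M T) S"
proof -
  have eq: "ground M - S - T = ground M - T - S"
    by auto
  have "rk (contract M S) X = rk (delete M T) (X \<union> S) - rk (delete M T) S"
    if "X \<subseteq> ground M - T - S" for X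
  proof -
    have "X \<subseteq> ground M - S" "X \<union> S \<subseteq> ground M - T" "S \<subseteq> ground M - T"
      using that assms by auto
    then show ?thesis
      by (simp add: contract_def delete_def)
  qed
  moreover have "ground (contract M S) = ground M - S" "ground (delete M T) = ground M - T"
    by (simp_all add: contract_def delete_def)
  ultimately show ?thesis
    unfolding contract_def[of "delete M T"] delete_def[of "contract M S"]
    by (auto intro!: restrict_ext simp: eq)
qed

text \<open>Each element keeps its own operation, so reversing two steps gives the first candidate
  for another ordering.\<close>

lemma remove_by_commute:
  assumes "a \<in> ground M" "b \<in> ground M" "a \<noteq> b"
  shows "remove_by q (remove_by p M a) b = remove_by p (remove_by q M b) a"
  using assms
  by (cases p; cases q) (simp_all add: delete_delete contract_contract delete_contract insert_commute)

section \<open>Summands and connectivity\<close>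

text \<open>The claim is r(X + a) = r(X) + r(a) for every X avoiding a. One inequality is
  subadditivity; the other is submodularity for X + a and E - a, combined with the summand
  equation.\<close>

lemma remove_by_eq_if_summand:
  assumes K: "k_polymatroid k K" and a: "a \<in> ground K" and s: "summand K a"
  shows "remove_by p K a = remove_by q K a"
proof -
  have "rk K X = rk K (X \<union> {a}) - rk K {a}" if X: "X \<subseteq> ground K - {a}" for X
  proof -
    have eqs: "(X \<union> {a}) \<union> (ground K - {a}) = ground K"
      "(X \<union> {a}) \<inter> (ground K - {a}) = X" "X \<inter> {a} = {}"
      and sub: "X \<union> {a} \<subseteq> ground K" "X \<subseteq> ground K" "{a} \<subseteq> ground K"
      using X a by auto
    have "rk K (ground K) + rk K X \<le> rk K (X \<union> {a}) + rk K (ground K - {a})"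
      using rk_submodular[OF K sub(1) Diff_subset[of "ground K" "{a}"]] unfolding eqs .
    moreover have "rk K (X \<union> {a}) + rk K {} \<le> rk K X + rk K {a}"
      using rk_submodular[OF K sub(2,3)] unfolding eqs .
    ultimately show ?thesis
      using rk_empty[OF K] s unfolding summand_def by linarith
  qed
  then have "delete K {a} = contract K {a}"
    unfolding delete_def contract_def by (auto intro!: restrict_ext)
  then show ?thesis
    by (cases p; cases q) simp_all
qed

text \<open>It suffices to compare the two rank functions on the whole remaining ground set.\<close>

lemma summand_if_delete_eq_contract:
  assumes "delete K {a} = contract K {a}" "a \<in> ground K"
  shows "summand K a"
proof -
  have "rk (delete K {a}) (ground K - {a}) = rk (contract K {a}) (ground K - {a})"
    using assms by simp
  then show ?thesis
    using assms(2) by (simp add: delete_def contract_def summand_def insert_absorb)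
qed

text \<open>If the side \<open>A\<close> of a separation of \<open>K\<close> that contains
  \<open>a\<close> had a further element, then \<open>A - {a}\<close> and the other side would
  separate the minor, whichever operation removes \<open>a\<close>.\<close>

lemma not_connected_imp_summand:
  assumes K: "k_polymatroid k K" and a: "a \<in> ground K"
    and nc: "\<not> connected_pm K" and c: "connected_pm (remove_by p K a)"
  shows "summand K a"
proof -
  obtain X where X: "X \<noteq> {}" "X \<subset> ground K" "rk K X + rk K (ground K - X) = rk K (ground K)"
    using nc unfolding connected_pm_def by blast
  \<comment> \<open>Separations are symmetric, so the side containing \<open>a\<close> can be
    chosen.\<close>
  obtain A where A: "a \<in> A" "A \<subset> ground K" "rk K A + rk K (ground K - A) = rk K (ground K)"
  proof (cases "a \<in> X")
    case False
    then show ?thesis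
      using X a that[of "ground K - X"] by (auto simp: double_diff)
  qed (use X that in blast)
  define B where "B = ground K - A"
  have "A = {a}"
  proof (rule ccontr)
    assume "A \<noteq> {a}"
    then have ne: "A - {a} \<noteq> {}" and ss: "A - {a} \<subset> ground K - {a}"
      using A by auto
    have diff: "ground K - {a} - (A - {a}) = B"
      using A B_def by auto
    have sub: "A \<subseteq> ground K" "B \<subseteq> ground K" "A - {a} \<subseteq> ground K - {a}" "B \<subseteq> ground K - {a}"
      using A B_def by auto
    \<comment> \<open>In both cases two submodular inequalities enclose the sum of the ranks of the
      sides, and the separation equation for \<open>A\<close> forces equality.\<close>
    have "rk (remove_by p K a) (A - {a}) + rk (remove_by p K a) B
        = rk (remove_by p K a) (ground K - {a})"
    proof (cases p)
      case Deletion
      have eqs: "A \<union> (ground K - {a}) = ground K" "A \<inter> (ground K - {a}) = A - {a}"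
        "(A - {a}) \<union> B = ground K - {a}" "(A - {a}) \<inter> B = {}"
        and sub': "A - {a} \<subseteq> ground K"
        using A B_def by auto
      have "rk K (ground K) + rk K (A - {a}) \<le> rk K A + rk K (ground K - {a})"
        using rk_submodular[OF K sub(1) Diff_subset[of "ground K" "{a}"]] unfolding eqs .
      moreover have "rk K (ground K - {a}) + rk K {} \<le> rk K (A - {a}) + rk K B"
        using rk_submodular[OF K sub' sub(2)] unfolding eqs .
      ultimately have "rk K (A - {a}) + rk K B = rk K (ground K - {a})"
        using A(3) rk_empty[OF K] unfolding B_def[symmetric] by linarith
      then show ?thesis
        using Deletion sub by (simp add: delete_def)
    next
      case Contraction
      have eqs: "A \<union> (B \<union> {a}) = ground K" "A \<inter> (B \<union> {a}) = {a}" "B \<inter> {a} = {}"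
        and sub': "B \<union> {a} \<subseteq> ground K" "{a} \<subseteq> ground K"
        using A B_def by auto
      have "rk K (ground K) + rk K {a} \<le> rk K A + rk K (B \<union> {a})"
        using rk_submodular[OF K sub(1) sub'(1)] unfolding eqs .
      moreover have "rk K (B \<union> {a}) + rk K {} \<le> rk K B + rk K {a}"
        using rk_submodular[OF K sub(2) sub'(2)] unfolding eqs .
      ultimately have "rk K A + rk K (B \<union> {a}) - rk K {a} = rk K (ground K)"
        using A(3) rk_empty[OF K] unfolding B_def[symmetric] by linarith
      moreover have "A - {a} \<union> {a} = A" "ground K - {a} \<union> {a} = ground K"
        using A a by auto
      ultimately show ?thesis
        using Contraction sub by (simp add: contract_def insert_absorb a A(1))
    qed
    then show False
      using c ne ss diff unfolding connected_pm_def by auto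
  qed
  then show ?thesis
    using A unfolding summand_def by simp
qed

text \<open>The hypotheses on summands read r(a) + r(E - ab) = r(E - b) and r(ab) + r(E - b) = r(E)
  + r(a). Their sum says that \<open>{a, b}\<close> separates \<open>M\<close>, since it is a proper
  subset of the ground set.\<close>

lemma summand_delete_contract:
  assumes "connected_pm M" "a \<in> ground M" "b \<in> ground M" "a \<noteq> b" "ground M \<noteq> {a, b}"
    and d: "summand (remove_by Deletion M b) a"
    and c: "summand (remove_by Contraction M a) b"
  shows False
proof -
  have "ground M - {b} - {a} = ground M - {a, b}" "ground M - {a, b} \<subseteq> ground M - {b}"
    by auto
  then have "rk M {a} + rk M (ground M - {a, b}) = rk M (ground M - {b})"
    using d assms(2-4) unfolding summand_def by (simp add: delete_def)
  moreover have "rk M {a, b} - rk M {a} + (rk M (ground M - {b}) - rk M {a})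
      = rk M (ground M) - rk M {a}"
  proof -
    have rk: "rk (contract M {a}) X = rk M (X \<union> {a}) - rk M {a}" if "X \<subseteq> ground M - {a}" for X
      using that by (simp add: contract_def)
    have eqs: "{b} \<union> {a} = {a, b}" "ground M - {a} - {b} \<union> {a} = ground M - {b}"
      "ground M - {a} \<union> {a} = ground M" and b: "{b} \<subseteq> ground M - {a}"
      using assms(2-4) by auto
    have "ground (contract M {a}) = ground M - {a}"
      by (simp add: contract_def)
    then show ?thesis
      using c unfolding summand_def remove_by.simps
      by (simp only: rk[OF b] rk[OF Diff_subset] rk[OF order_refl] eqs)
  qed
  ultimately have "rk M {a, b} + rk M (ground M - {a, b}) = rk M (ground M)"
    by simp
  then show False
    using assms(1-3,5) unfolding connected_pm_def
    by (metis Diff_empty empty_not_insert empty_subsetI insert_subset psubsetI)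
qed

section \<open>Exchanging two consecutive steps\<close>

text \<open>Three alternatives are tried in turn: reverse the order, change the operation on
  \<open>a\<close>, and finally do the reverse with both operations changed. Each failure supplies a
  summand which ensures that the next alternative has the right outcome.\<close>

lemma two_steps_not_unique:
  assumes M: "k_polymatroid k M" "connected_pm M"
    and ab: "a \<in> ground M" "b \<in> ground M" "a \<noteq> b"
    and N: "connected_pm (remove_by q (remove_by p M a) b)"
  shows "\<exists>p' a' q' b'. ((p', a'), (q', b')) \<noteq> ((p, a), (q, b)) \<and> {a', b'} = {a, b} \<and>
    connected_pm (remove_by p' M a') \<and>
    remove_by q' (remove_by p' M a') b' = remove_by q (remove_by p M a) b"
    (is "\<exists>p' a' q' b'. ?P p' a' q' b'")
proof -
  define con where "con u x = connected_pm (remove_by u M x)" for u x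
  define res where "res u x v y = remove_by v (remove_by u M x) y" for u x v y
  define sum where "sum u x y = summand (remove_by u M x) y" for u x y
  have comm: "res u a v b = res v b u a" for u v
    unfolding res_def using remove_by_commute[OF ab] by simp
  \<comment> \<open>A blocked route, with disconnected intermediate polymatroid but connected
    outcome, makes the element still to be removed a summand.\<close>
  have sum_a: "sum u b a" if "\<not> con u b" "connected_pm (res u b v a)" for u v
    using not_connected_imp_summand[OF k_polymatroid_remove_by[OF M(1)]] that ab
    unfolding sum_def con_def res_def by simp
  have sum_b: "sum u a b" if "\<not> con u a" "connected_pm (res u a v b)" for u v
    using not_connected_imp_summand[OF k_polymatroid_remove_by[OF M(1)]] that ab
    unfolding sum_def con_def res_def by simp
  have eq_a: "res u b v a = res u b w a" if "sum u b a" for u v w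
    using remove_by_eq_if_summand[OF k_polymatroid_remove_by[OF M(1)]] that ab
    unfolding sum_def res_def by simp
  have eq_b: "res u a v b = res u a w b" if "sum u a b" for u v w
    using remove_by_eq_if_summand[OF k_polymatroid_remove_by[OF M(1)]] that ab
    unfolding sum_def res_def by simp
  have alt: ?thesis
    if "con u x" "res u x v y = res p a q b" "((u, x), (v, y)) \<noteq> ((p, a), (q, b))"
      "x = a \<and> y = b \<or> x = b \<and> y = a" for u x v y
  proof -
    have "?P u x v y"
      using that unfolding con_def res_def by auto
    then show ?thesis by blast
  qed
  have conN: "connected_pm (res p a q b)"
    using N by (simp add: res_def)
  show ?thesis
  proof (cases "con q b")
    case True
    show ?thesis
      by (rule alt[OF True, of p a]) (use ab comm in auto)
  next
    case nq: False
    \<comment> \<open>On two elements the intermediate polymatroid would have a single element,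
      hence be connected.\<close>
    have ne: "ground M \<noteq> {a, b}"
    proof
      assume "ground M = {a, b}"
      then have "ground (remove_by q M b) = {a}"
        using ab by auto
      then show False
        using nq unfolding con_def connected_pm_def by (auto simp: psubset_eq subset_singleton_iff)
    qed
    have x1: "\<not> (sum Deletion b a \<and> sum Contraction a b)"
      using summand_delete_contract[OF M(2) ab ne] unfolding sum_def by blast
    have x2: "\<not> (sum Deletion a b \<and> sum Contraction b a)"
      using summand_delete_contract[OF M(2) ab(2,1) ab(3)[symmetric]] ne
      unfolding sum_def by (auto simp: insert_commute)
    \<comment> \<open>\<open>p'\<close> and \<open>q'\<close> are the operations opposite to
      \<open>p\<close> and \<open>q\<close>.\<close>
    define p' where "p' = (case p of Deletion \<Rightarrow> Contraction | Contraction \<Rightarrow> Deletion)"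
    define q' where "q' = (case q of Deletion \<Rightarrow> Contraction | Contraction \<Rightarrow> Deletion)"
    have neq: "p' \<noteq> p" "q' \<noteq> q"
      unfolding p'_def q'_def by (cases p; simp; fail) (cases q; simp)
    have s1: "sum q b a"
      using sum_a[OF nq] conN comm by metis
    \<comment> \<open>After \<open>b\<close> is removed by \<open>q\<close>, both operations on
      \<open>a\<close> agree; commuting carries this over to the order a, b.\<close>
    have r1: "res p' a q b = res p a q b"
      using eq_a[OF s1] comm by metis
    show ?thesis
    proof (cases "con p' a")
      case True
      show ?thesis
        by (rule alt[OF True r1]) (use neq in auto)
    next
      case np: False
      have s2: "sum p' a b"
        using sum_b[OF np] conN r1 by metis
      have r2: "res q' b p' a = res p a q b"
        using eq_b[OF s2] comm r1 by metis
      show ?thesis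
      proof (cases "con q' b")
        case True
        show ?thesis
          by (rule alt[OF True r2]) (use ab in auto)
      next
        case nq': False
        have s3: "sum q' b a"
          using sum_a[OF nq'] conN r2 by metis
        show ?thesis
          \<comment> \<open>As \<open>q\<close> and \<open>q'\<close> are the two operations,
            \<open>a\<close> is a summand both of M\<setminus>b and of M/b. Whichever operation
            \<open>p'\<close> is, \<open>s2\<close> then contradicts \<open>x1\<close> or
            \<open>x2\<close>.\<close>
          using s1 s2 s3 x1 x2 unfolding p'_def q'_def
          by (cases p; cases q) auto
      qed
    qed
  qed
qed

section \<open>Constrained admissible orderings\<close>

lemma constrained_admissible_orderingE:
  assumes "constrained_admissible_ordering M N os"
  obtains Ms where "distinct (map snd os)" "snd ` set os = ground M - ground N"
    "Ms 0 = M" "Ms (length os) = N"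
    "\<forall>k \<in> {1..length os}. is_minor M (Ms k) \<and> connected_pm (Ms k) \<and>
       ground (Ms k) = ground M - snd ` set (take k os) \<and>
       Ms k = remove_by (fst (os ! (k - 1))) (Ms (k - 1)) (snd (os ! (k - 1)))"
  using assms unfolding constrained_admissible_ordering_def
  by (elim conjE exE) (rule that)

text \<open>Only the polymatroid reached after one step changes; from the second on, the old
  sequence of minors serves again.\<close>

lemma constrained_admissible_ordering_replace:
  assumes os: "constrained_admissible_ordering M N ((p, a) # (q, b) # os)"
    and ab: "{a', b'} = {a, b}"
    and con: "connected_pm (remove_by p' M a')"
    and eq: "remove_by q' (remove_by p' M a') b' = remove_by q (remove_by p M a) b"
  shows "constrained_admissible_ordering M N ((p', a') # (q', b') # os)"
proof -
  let ?os = "(p, a) # (q, b) # os" and ?os' = "(p', a') # (q', b') # os"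
  obtain Ms where dist: "distinct (map snd ?os)" and rng: "snd ` set ?os = ground M - ground N"
    and Ms: "Ms 0 = M" "Ms (length ?os) = N"
    and step: "\<forall>k \<in> {1..length ?os}. is_minor M (Ms k) \<and> connected_pm (Ms k) \<and>
           ground (Ms k) = ground M - snd ` set (take k ?os) \<and>
           Ms k = remove_by (fst (?os ! (k - 1))) (Ms (k - 1)) (snd (?os ! (k - 1)))"
    using os by (rule constrained_admissible_orderingE)
  have dist': "distinct (map snd ?os')"
    using dist ab by (auto simp: doubleton_eq_iff)
  have rng': "snd ` set ?os' = ground M - ground N"
    using rng ab by (auto simp: doubleton_eq_iff)
  have Ms1: "Ms 1 = remove_by p M a"
    using bspec[OF step, of 1] Ms by simp
  have Ms2: "Ms 2 = remove_by q (remove_by p M a) b"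
    using bspec[OF step, of 2] Ms1 by (simp add: numeral_2_eq_2)
  define Ms' where "Ms' = Ms(1 := remove_by p' M a')"
  have a': "a' \<in> ground M"
    using rng' by auto
  have step': "is_minor M (Ms' k) \<and> connected_pm (Ms' k) \<and>
           ground (Ms' k) = ground M - snd ` set (take k ?os') \<and>
           Ms' k = remove_by (fst (?os' ! (k - 1))) (Ms' (k - 1)) (snd (?os' ! (k - 1)))"
    if k: "k \<in> {1..length ?os'}" for k
  proof (cases "k = 1")
    case True
    then show ?thesis
      using con is_minor_remove_by[OF is_minor.refl a'] Ms by (simp add: Ms'_def)
  next
    case False
    then obtain j where j: "k = Suc (Suc j)"
      using k by (metis One_nat_def atLeastAtMost_iff not0_implies_Suc not_one_le_zero)
    \<comment> \<open>Prefixes of length at least two contain both exchanged elements.\<close>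
    have gr: "snd ` set (take k ?os') = snd ` set (take k ?os)"
      using ab j by (auto simp: doubleton_eq_iff)
    have "Ms' k = remove_by (fst (?os' ! (k - 1))) (Ms' (k - 1)) (snd (?os' ! (k - 1)))"
    \<comment> \<open>\<open>j = 0\<close> is the second step, the only one that starts from the
      altered \<open>Ms' 1\<close>; it is covered by \<open>eq\<close>.\<close>
    proof (cases j)
      case 0
      then show ?thesis
        using j Ms2 eq by (simp add: Ms'_def numeral_2_eq_2)
    next
      case (Suc i)
      then show ?thesis
        using bspec[OF step, of k] k j by (simp add: Ms'_def)
    qed
    moreover have "Ms' k = Ms k"
      using j by (simp add: Ms'_def)
    moreover have "k \<in> {1..length ?os}"
      using k by simp
    ultimately show ?thesis
      using bspec[OF step, of k] gr by metis
  qed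
  have "Ms' 0 = M" "Ms' (length ?os') = N"
    using Ms by (simp_all add: Ms'_def)
  then show ?thesis
    unfolding constrained_admissible_ordering_def
    by (intro conjI exI[of _ Ms'] ballI dist' rng') (use step' in blast)+
qed

lemma constrained_admissible_ordering_single:
  assumes "connected_pm (remove_by p M a)" "a \<in> ground M"
  shows "constrained_admissible_ordering M (remove_by p M a) [(p, a)]"
  unfolding constrained_admissible_ordering_def
proof (intro conjI exI[of _ "\<lambda>k. if k = 0 then M else remove_by p M a"])
qed (use assms is_minor_remove_by[OF is_minor.refl] in auto)

lemma constrained_admissible_ordering_length:
  assumes "constrained_admissible_ordering M N os"
  shows "length os = card (ground M - ground N)"
  using assms unfolding constrained_admissible_ordering_def
  by (metis distinct_card length_map set_map)

lemma constrained_admissible_ordering_singleD: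
  assumes "constrained_admissible_ordering M N [(p, a)]"
  shows "N = remove_by p M a \<and> ground M - ground N = {a}"
  using assms by (rule constrained_admissible_orderingE) auto

theorem theorem4p1:
  fixes M N :: "'a polymat"
  assumes "k_polymatroid 2 M"
    and "connected_pm M"
    and "proper_minor M N"
    and "connected_pm N"
    and "card (ground M) \<noteq> 1"
  shows "(\<exists>!os. constrained_admissible_ordering M N os)
           \<longleftrightarrow> card (ground M - ground N) = 1"
proof
  assume "\<exists>!os. constrained_admissible_ordering M N os"
  then obtain os where os: "constrained_admissible_ordering M N os"
    and uniq: "\<And>os'. constrained_admissible_ordering M N os' \<Longrightarrow> os' = os"
    by blast
  show "card (ground M - ground N) = 1"
  proof (rule ccontr)
    assume "card (ground M - ground N) \<noteq> 1"
    \<comment> \<open>The ground set is finite, so cardinality 0 means that nothing was removed,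
      which properness of the minor excludes.\<close>
    moreover have "card (ground M - ground N) \<noteq> 0"
    proof
      assume "card (ground M - ground N) = 0"
      then have "ground N = ground M"
        using assms(1,3) ground_minor[of M N]
        by (auto simp: k_polymatroid_def proper_minor_def)
      then show False
        using assms(1,3) minor_same_ground unfolding proper_minor_def by blast
    qed
    ultimately have "length os \<ge> 2"
      using constrained_admissible_ordering_length[OF os] by linarith
    then obtain p a q b os' where os_eq: "os = (p, a) # (q, b) # os'"
      by (metis One_nat_def Suc_1 Suc_le_length_iff surj_pair)
    obtain Ms where set_os: "distinct (map snd os)" "snd ` set os = ground M - ground N"
      and Ms0: "Ms 0 = M" "Ms (length os) = N"
      and step: "\<forall>k \<in> {1..length os}. is_minor M (Ms k) \<and> connected_pm (Ms k) \<and>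
           ground (Ms k) = ground M - snd ` set (take k os) \<and>
           Ms k = remove_by (fst (os ! (k - 1))) (Ms (k - 1)) (snd (os ! (k - 1)))"
      using os by (rule constrained_admissible_orderingE)
    have ab: "a \<in> ground M" "b \<in> ground M" "a \<noteq> b"
      using set_os by (auto simp: os_eq)
    have "Ms 1 = remove_by p M a"
      using bspec[OF step, of 1] Ms0 by (simp add: os_eq)
    moreover have "2 \<in> {1..length os}"
      by (simp add: os_eq)
    then have "connected_pm (Ms 2)" "Ms 2 = remove_by q (Ms 1) b"
      using bspec[OF step, of 2] by (blast, simp add: os_eq)
    ultimately have "connected_pm (remove_by q (remove_by p M a) b)"
      by simp
    from two_steps_not_unique[OF assms(1,2) ab this]
    obtain p' a' q' b' where alt: "((p', a'), (q', b')) \<noteq> ((p, a), (q, b))"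
      "{a', b'} = {a, b}" "connected_pm (remove_by p' M a')"
      "remove_by q' (remove_by p' M a') b' = remove_by q (remove_by p M a) b"
      by (elim exE conjE) (rule that)
    have "constrained_admissible_ordering M N ((p', a') # (q', b') # os')"
      using constrained_admissible_ordering_replace[OF os[unfolded os_eq] alt(2-4)] .
    from uniq[OF this] show False
      using alt(1) os_eq by simp
  qed
next
  assume card1: "card (ground M - ground N) = 1"
  then obtain a where a: "ground M - ground N = {a}"
    by (auto simp: card_1_singleton_iff)
  then have aM: "a \<in> ground M"
    by blast
  obtain p where p: "N = remove_by p M a"
    using minor_remove_one[OF _ assms(1) a] assms(3) unfolding proper_minor_def by blast
  \<comment> \<open>On the ground set \<open>{a}\<close> deleting and contracting \<open>a\<close>
    both give the empty polymatroid, so two orderings would exist. Otherwise \<open>{a}\<close> is a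
    proper subset and connectivity applies to it.\<close>
  have "ground M \<noteq> {a}"
    using assms(5) by auto
  then have nsum: "\<not> summand M a"
    using assms(2) aM unfolding summand_def connected_pm_def by blast
  show "\<exists>!os. constrained_admissible_ordering M N os"
  proof (rule ex1I)
    show "constrained_admissible_ordering M N [(p, a)]"
      using constrained_admissible_ordering_single[of p M a] assms(4) aM p by simp
  next
    fix os assume os: "constrained_admissible_ordering M N os"
    then have "length os = 1"
      using constrained_admissible_ordering_length card1 by metis
    then obtain q b where os_eq: "os = [(q, b)]"
      by (metis One_nat_def length_0_conv length_Suc_conv surj_pair)
    have b: "b = a"
      using constrained_admissible_ordering_singleD[OF os[unfolded os_eq]] a by simp
    have eq: "remove_by q M a = remove_by p M a"
      using constrained_admissible_ordering_singleD[OF os[unfolded os_eq]] p b by simp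
    \<comment> \<open>Hence \<open>N\<close> determines the operation applied to
      \<open>a\<close>.\<close>
    have "delete M {a} \<noteq> contract M {a}"
      using nsum summand_if_delete_eq_contract[OF _ aM] by blast
    then have "q = p"
      using eq by (cases p; cases q) (simp_all add: eq_commute)
    then show "os = [(p, a)]"
      by (simp add: os_eq b)
  qed
qed

end
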